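(* Let $E$ be a nonempty subset of a real Hilbert space $X$, $f:E\to\mathbb{R}$ and $G:E\to X$ two functions, and $c\in\mathbb{R}$, $M>0$ two constants with $M>c$. There exists a function $F\in C^{1,1}(X)$ such that $F=f$ and $\nabla F=G$ on $E$, $\mathrm{Lip}(\nabla F)\le M$, and $F-\tfrac c2\|\cdot\|^2$ is a convex function, if and only if the jet $(f,G)$ satisfies condition $(SCW^{1,1})$ with constants $(c,M)$ on $E$. In fact, (when this condition holds) $F$ can be defined by means of the formula $$F=\mathrm{conv}(g)+\tfrac c2\|\cdot\|^2,$$ $$g(x)=\inf_{y\in E}\left\{f(y)+\langle G(y),x-y\rangle+\tfrac M2\|x-y\|^2\right\}-\tfrac c2\|x\|^2,\qquad x\in X.$$ Moreover, for this $F$, if $H$ is another function of class $C^{1,1}(X)$ with $H=f$ and $\nabla H=G$ on $E$, $\mathrm{Lip}(\nabla H)\le M$, and $H-\tfrac c2\|\cdot\|^2$ convex, then $H\le F$ on $X$.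
   Context: $\langle\cdot,\cdot\rangle$ and $\|\cdot\|$ denote the inner product and norm of $X$. $C^{1,1}(X)$ is the class of Fréchet differentiable functions $F:X\to\mathbb{R}$ whose gradient $\nabla F:X\to X$ (the Riesz representative of the Fréchet derivative) is Lipschitz; $\mathrm{Lip}(\nabla F)=\sup_{x\ne y}\frac{\|\nabla F(x)-\nabla F(y)\|}{\|x-y\|}$. For $c\in\mathbb{R}$, $M>0$, $M>c$, the $1$-jet $(f,G):E\to\mathbb{R}\times X$ satisfies $(SCW^{1,1})$ with constants $(c,M)$ on $E$ if for every $x,y\in E$ $$f(x)\ge f(y)+\langle G(y),x-y\rangle+\tfrac{c}{M-c}\langle G(x)-G(y),y-x\rangle+\tfrac{cM}{2(M-c)}\|x-y\|^2+\tfrac{1}{2(M-c)}\|G(x)-G(y)\|^2.$$ The convex envelope of $g:X\to\mathbb{R}$ is $\mathrm{conv}(g)(x)=\sup\{h(x): h \text{ convex, proper, lower semicontinuous on } X,\ h\le g\}$.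
   Formalization: The equivalence and the bound Lip(∇F) ≤ M for the F of the formula are asserted only for −M ≤ c < M, as they fail for c < −M (X=E=ℝ, c=−2, M=1, f=−x², G=−2x); necessity of the condition, the formula, convexity and maximality are kept for all c < M. *)

theory Defs
  imports "HOL-Analysis.Analysis"
begin

text \<open>The gradient is the Riesz representative of the Frechet derivative: \<open>GDERIV F x :> D\<close> says
  that \<open>\<lambda>h. h \<bullet> D\<close> is the derivative of \<open>F\<close> at \<open>x\<close>. On a Hilbert space it exists wherever \<open>F\<close> is
  differentiable, so the value of \<open>grad\<close> is meaningful there.\<close>

definition grad :: "('a::real_inner \<Rightarrow> real) \<Rightarrow> 'a \<Rightarrow> 'a" where
  "grad F x = (THE D. GDERIV F x :> D)"

definition C11 :: "('a::real_inner \<Rightarrow> real) \<Rightarrow> bool" where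
  "C11 F \<longleftrightarrow> (\<forall>x. F differentiable (at x)) \<and> (\<exists>L. L-lipschitz_on UNIV (grad F))"

text \<open>The supremum is taken in \<open>ennreal\<close>, so that it always exists, and is \<open>0\<close> on the trivial space,
  where there are no \<open>x \<noteq> y\<close>.\<close>

definition Lip :: "('a::real_normed_vector \<Rightarrow> 'a) \<Rightarrow> ennreal" where
  "Lip T = (SUP (x, y)\<in>{(x, y). x \<noteq> y}. ennreal (norm (T x - T y) / norm (x - y)))"

text \<open>When \<open>c < - M\<close> the condition does not force \<open>Lip (grad F) \<le> M\<close>, only
  \<open>Lip (grad F) \<le> max M (- c)\<close>: on the real line, \<open>f x = - x\<^sup>2\<close> with \<open>G x = - 2 * x\<close> satisfies it
  for \<open>c = - 2\<close> and \<open>M = 1\<close>. Bounding \<open>Lip (grad F)\<close> by \<open>M\<close> therefore requires \<open>- M \<le> c\<close>.\<close>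

definition SCW11 :: "real \<Rightarrow> real \<Rightarrow> 'a::real_inner set \<Rightarrow> ('a \<Rightarrow> real) \<Rightarrow> ('a \<Rightarrow> 'a) \<Rightarrow> bool" where
  "SCW11 c M E f G \<longleftrightarrow> (\<forall>x\<in>E. \<forall>y\<in>E.
     f x \<ge> f y + G y \<bullet> (x - y)
          + c / (M - c) * ((G x - G y) \<bullet> (y - x))
          + c * M / (2 * (M - c)) * (norm (x - y))\<^sup>2
          + 1 / (2 * (M - c)) * (norm (G x - G y))\<^sup>2)"

definition ereal_proper :: "('a \<Rightarrow> ereal) \<Rightarrow> bool" where
  "ereal_proper h \<longleftrightarrow> (\<forall>x. h x \<noteq> -\<infinity>) \<and> (\<exists>x. h x \<noteq> \<infinity>)"

text \<open>Only used for proper functions, so the sum on the right is never of the form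
  \<open>\<infinity> + (-\<infinity>)\<close>; recall that \<open>0 * \<infinity> = 0\<close> in \<open>ereal\<close>.\<close>

definition ereal_convex :: "('a::real_vector \<Rightarrow> ereal) \<Rightarrow> bool" where
  "ereal_convex h \<longleftrightarrow> (\<forall>x y. \<forall>t\<in>{0..1}.
     h ((1 - t) *\<^sub>R x + t *\<^sub>R y) \<le> ereal (1 - t) * h x + ereal t * h y)"

definition lower_semicont :: "('a::topological_space \<Rightarrow> ereal) \<Rightarrow> bool" where
  "lower_semicont h \<longleftrightarrow> (\<forall>x. h x \<le> Liminf (at x) h)"

definition conv_envelope :: "('a::real_normed_vector \<Rightarrow> ereal) \<Rightarrow> 'a \<Rightarrow> ereal" where
  "conv_envelope g x =
     (SUP h\<in>{h. ereal_convex h \<and> ereal_proper h \<and> lower_semicont h \<and> h \<le> g}. h x)"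

text \<open>The function \<open>g\<close>. The infimum is taken in \<open>ereal\<close>, so that it is \<open>-\<infinity>\<close> where the
  family is unbounded below.\<close>

definition jet_inf :: "real \<Rightarrow> real \<Rightarrow> 'a::real_inner set \<Rightarrow> ('a \<Rightarrow> real) \<Rightarrow> ('a \<Rightarrow> 'a) \<Rightarrow> 'a \<Rightarrow> ereal" where
  "jet_inf c M E f G x =
     (INF y\<in>E. ereal (f y + G y \<bullet> (x - y) + M / 2 * (norm (x - y))\<^sup>2)) - ereal (c / 2 * (norm x)\<^sup>2)"

definition extends_jet :: "'a::real_inner set \<Rightarrow> ('a \<Rightarrow> real) \<Rightarrow> ('a \<Rightarrow> 'a) \<Rightarrow> ('a \<Rightarrow> real) \<Rightarrow> bool" where
  "extends_jet E f G F \<longleftrightarrow> (\<forall>x\<in>E. F x = f x \<and> grad F x = G x)"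

end

theory Submission
  imports Defs
begin

text \<open>Subtracting \<open>c / 2 \<parallel>x\<parallel>\<^sup>2\<close> reduces everything to \<open>c = 0\<close> with \<open>L = M - c\<close> in place of
  \<open>M\<close>. The condition then says that every tangent \<open>f y + \<langle>G y, x - y\<rangle>\<close> lies below every
  paraboloid \<open>f z + \<langle>G z, x - z\<rangle> + L / 2 \<parallel>x - z\<parallel>\<^sup>2\<close>, so that the convex envelope \<open>\<phi>\<close> of the infimum
  of the paraboloids is squeezed between the two and has the prescribed jet on \<open>E\<close>. Since the
  envelope is the largest convex minorant, it inherits the bound
  \<open>\<phi> (x + h) + \<phi> (x - h) - 2 \<phi> x \<le> L \<parallel>h\<parallel>\<^sup>2\<close>, which together with convexity makes its directional
  derivatives linear and its gradient cocoercive. Any other extension minus \<open>c / 2 \<parallel>x\<parallel>\<^sup>2\<close> is convex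
  and, by the descent lemma, below all the paraboloids, hence below \<open>\<phi>\<close>.\<close>

section \<open>Gradients on a Hilbert space\<close>

lemma linear_term_zero_if_quadratic_nonneg:
  fixes a b :: real
  assumes "b \<ge> 0" and nonneg: "\<And>t. 0 \<le> t * a + t\<^sup>2 * b"
  shows "a = 0"
proof -
  \<comment> \<open>Dividing by \<open>b + 1\<close> is safe even for \<open>b = 0\<close>, and at
    this \<open>t\<close> the quadratic takes the value \<open>- t\<^sup>2\<close>.\<close>
  define t where "t = - a / (b + 1)"
  have a: "a = - t * (b + 1)" using \<open>b \<ge> 0\<close> by (simp add: t_def)
  have "0 \<le> - t\<^sup>2" using nonneg[of t] unfolding a by (simp add: power2_eq_square algebra_simps)
  then show ?thesis by (simp add: a)
qed

text \<open>The representative minimises \<open>\<parallel>h\<parallel>\<^sup>2 / 2 - D h\<close>; minimising sequences are Cauchy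
  by the parallelogram law.\<close>

lemma riesz_representation:
  fixes D :: "'a::{real_inner, banach} \<Rightarrow> real"
  assumes "bounded_linear D"
  obtains p where "\<And>h. D h = h \<bullet> p"
proof -
  interpret D: bounded_linear D by fact
  obtain B where B: "\<And>h. norm (D h) \<le> norm h * B" using D.bounded by blast
  define J where "J h = (norm h)\<^sup>2 / 2 - D h" for h
  have J_lower: "- B\<^sup>2 / 2 \<le> J h" for h
  proof -
    have "D h \<le> norm h * B" using B[of h] by simp
    moreover have "0 \<le> (norm h - B)\<^sup>2" by simp
    ultimately show ?thesis unfolding J_def by (simp add: power2_diff)
  qed
  define m where "m = (INF h. J h)"
  have bdd: "bdd_below (range J)" by (intro bdd_belowI2[of _ "- B\<^sup>2 / 2"] J_lower)
  have m_le: "m \<le> J h" for h unfolding m_def using bdd by (intro cINF_lower) auto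
  have "\<exists>h. J h < m + 1 / real (Suc n)" for n
  proof -
    have "(INF h. J h) < m + 1 / real (Suc n)" unfolding m_def by simp
    then show ?thesis using bdd by (subst (asm) cINF_less_iff) auto
  qed
  then obtain s where s: "\<And>n. J (s n) < m + 1 / real (Suc n)" by metis
  have gap: "(norm (a - b))\<^sup>2 \<le> 4 * (J a + J b - 2 * m)" for a b
  proof -
    have "J ((1/2) *\<^sub>R (a + b)) = (J a + J b) / 2 - (norm (a - b))\<^sup>2 / 8"
      unfolding J_def by (simp add: D.scaleR D.add power2_norm_eq_inner inner_simps
          inner_commute[of b a] field_simps)
    then show ?thesis using m_le[of "(1/2) *\<^sub>R (a + b)"] by argo
  qed
  have "Cauchy s"
  proof (rule metric_CauchyI)
    fix e :: real assume "e > 0"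
    \<comment> \<open>From index \<open>N\<close> on, \<open>J\<close> exceeds \<open>m\<close> by
      less than \<open>1 / N\<close>, so \<open>gap\<close> bounds the squared distance by
      \<open>8 / N\<close>.\<close>
    obtain N where N: "8 / e\<^sup>2 < real N" using reals_Archimedean2 by blast
    have "dist (s i) (s j) < e" if "i \<ge> N" "j \<ge> N" for i j
    proof -
      have "N > 0"
      proof (rule Nat.gr0I)
        assume "N = 0"
        moreover have "0 \<le> 8 / e\<^sup>2" by simp
        ultimately show False using N by simp
      qed
      have le: "1 / real (Suc k) \<le> 1 / real N" if "k \<ge> N" for k
        using that \<open>N > 0\<close> by (intro divide_left_mono) auto
      have "(norm (s i - s j))\<^sup>2 \<le> 4 * (J (s i) + J (s j) - 2 * m)" by (rule gap)
      also have "\<dots> < 4 * (1 / real (Suc i) + 1 / real (Suc j))" using s[of i] s[of j] by simp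
      also have "\<dots> \<le> 8 / real N" using le[OF that(1)] le[OF that(2)] by simp
      also have "\<dots> < e\<^sup>2" using N \<open>N > 0\<close> \<open>e > 0\<close> by (simp add: field_simps)
      finally show ?thesis unfolding dist_norm using \<open>e > 0\<close> by (simp add: power_less_imp_less_base)
    qed
    then show "\<exists>N. \<forall>i\<ge>N. \<forall>j\<ge>N. dist (s i) (s j) < e" by blast
  qed
  then obtain p where p: "s \<longlonglongrightarrow> p" using Cauchy_convergent convergent_def by blast
  have "(\<lambda>n. J (s n)) \<longlonglongrightarrow> J p"
    unfolding J_def by (intro tendsto_intros p D.tendsto) simp
  moreover have "(\<lambda>n. m + 1 / real (Suc n)) \<longlonglongrightarrow> m + 0"
    by (intro tendsto_intros LIMSEQ_Suc[OF lim_1_over_n])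
  ultimately have "J p \<le> m + 0"
    by (rule LIMSEQ_le) (use s less_imp_le in blast)
  then have J_min: "J p \<le> J h" for h using m_le[of h] by simp
  \<comment> \<open>First variation at the minimiser: \<open>J (p + t *\<^sub>R h) - J p\<close> is
    a nonnegative quadratic in \<open>t\<close>, so its linear coefficient vanishes.\<close>
  have "D h = h \<bullet> p" for h
  proof -
    have "0 \<le> t * (h \<bullet> p - D h) + t\<^sup>2 * ((norm h)\<^sup>2 / 2)" for t
      using J_min[of "p + t *\<^sub>R h"] unfolding J_def power2_norm_eq_inner
      by (simp add: D.scaleR D.add inner_simps inner_commute[of p h]
          algebra_simps power2_eq_square)
    then have "h \<bullet> p - D h = 0" by (rule linear_term_zero_if_quadratic_nonneg[rotated]) auto
    then show ?thesis by simp
  qed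
  then show ?thesis by (rule that)
qed

lemma grad_eqI: "GDERIV F x :> p \<Longrightarrow> grad F x = p"
  unfolding grad_def
proof (rule the_equality)
  fix D assume "GDERIV F x :> p" "GDERIV F x :> D"
  then have "(\<lambda>h. h \<bullet> D) = (\<lambda>h. h \<bullet> p)"
    unfolding gderiv_def using has_derivative_unique by blast
  then have "h \<bullet> D = h \<bullet> p" for h by meson
  then show "D = p" using vector_eq_ldot by blast
qed

text \<open>Completeness enters through Riesz: every Frechet derivative has a representative, so
  differentiability alone gives \<open>grad\<close> its meaning.\<close>

lemma gderiv_grad:
  fixes F :: "'a::{real_inner, banach} \<Rightarrow> real"
  assumes "F differentiable (at x)"
  shows "GDERIV F x :> grad F x"
proof -
  obtain D where D: "(F has_derivative D) (at x)" using assms differentiable_def by blast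
  obtain p where "\<And>h. D h = h \<bullet> p"
    using riesz_representation[OF has_derivative_bounded_linear[OF D]] by blast
  then have "D = (\<lambda>h. h \<bullet> p)" by auto
  then have "GDERIV F x :> p" using D by (simp add: gderiv_def)
  then show ?thesis using grad_eqI by metis
qed

lemma gderiv_quadratic_error:
  assumes err: "\<And>h. \<bar>F (x + h) - F x - h \<bullet> p\<bar> \<le> a * (norm h)\<^sup>2"
  shows "GDERIV F x :> p"
  unfolding gderiv_def has_derivative_at_alt
proof (intro conjI allI impI)
  show "bounded_linear (\<lambda>h. h \<bullet> p)" by (rule bounded_linear_inner_left)
  fix e :: real assume "e > 0"
  show "\<exists>d>0. \<forall>y. norm (y - x) < d \<longrightarrow> norm (F y - F x - (y - x) \<bullet> p) \<le> e * norm (y - x)"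
  \<comment> \<open>\<open>\<bar>a\<bar> + 1\<close> keeps the radius well defined and positive
    whatever the value of \<open>a\<close>.\<close>
  proof (intro exI[of _ "e / (\<bar>a\<bar> + 1)"] conjI allI impI)
    show "0 < e / (\<bar>a\<bar> + 1)" using \<open>e > 0\<close> by simp
    fix y assume y: "norm (y - x) < e / (\<bar>a\<bar> + 1)"
    have "norm (F y - F x - (y - x) \<bullet> p) \<le> a * (norm (y - x))\<^sup>2"
      using err[of "y - x"] by simp
    also have "\<dots> \<le> ((\<bar>a\<bar> + 1) * norm (y - x)) * norm (y - x)"
      unfolding power2_eq_square mult.assoc[symmetric] by (intro mult_right_mono) auto
    also have "\<dots> \<le> e * norm (y - x)"
      using y by (intro mult_right_mono) (simp_all add: field_simps)
    finally show "norm (F y - F x - (y - x) \<bullet> p) \<le> e * norm (y - x)" .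
  qed
qed

lemma gderiv_along_line:
  assumes "GDERIV F (y + t *\<^sub>R d) :> p"
  shows "((\<lambda>t. F (y + t *\<^sub>R d)) has_real_derivative d \<bullet> p) (at t)"
proof -
  have "((\<lambda>t. y + t *\<^sub>R d) has_derivative (\<lambda>h. h *\<^sub>R d)) (at t)"
    by (auto intro!: derivative_eq_intros)
  from has_derivative_compose[OF this assms[unfolded gderiv_def]] show ?thesis
    by (simp add: has_field_derivative_def mult_commute_abs)
qed

lemma gderiv_half_norm_squared: "GDERIV (\<lambda>x. c / 2 * (norm x)\<^sup>2) x :> c *\<^sub>R x"
proof (rule gderiv_quadratic_error)
  fix h
  have "c / 2 * (norm (x + h))\<^sup>2 - c / 2 * (norm x)\<^sup>2 - h \<bullet> c *\<^sub>R x = c / 2 * (norm h)\<^sup>2"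
    by (simp add: power2_norm_eq_inner inner_left_distrib inner_right_distrib inner_commute[of x h]
        algebra_simps)
  then show "\<bar>c / 2 * (norm (x + h))\<^sup>2 - c / 2 * (norm x)\<^sup>2 - h \<bullet> c *\<^sub>R x\<bar>
      \<le> \<bar>c\<bar> / 2 * (norm h)\<^sup>2"
    by (simp only:) (simp add: abs_mult)
qed

text \<open>For \<open>M \<ge> 0\<close> the cast to \<open>ennreal\<close> preserves order, and the
  pairs \<open>x = y\<close> left out of the supremum satisfy the inequality trivially.\<close>

lemma Lip_le_iff:
  fixes T :: "'a::real_normed_vector \<Rightarrow> 'a"
  assumes "M \<ge> 0"
  shows "Lip T \<le> ennreal M \<longleftrightarrow> (\<forall>x y. norm (T x - T y) \<le> M * norm (x - y))"
proof -
  have "Lip T \<le> ennreal M \<longleftrightarrow>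
      (\<forall>x y. x \<noteq> y \<longrightarrow> norm (T x - T y) / norm (x - y) \<le> M)"
    unfolding Lip_def using assms by (auto simp: SUP_le_iff ennreal_le_iff)
  also have "\<dots> \<longleftrightarrow> (\<forall>x y. norm (T x - T y) \<le> M * norm (x - y))"
  proof (intro iff_allI)
    fix x y show "(x \<noteq> y \<longrightarrow> norm (T x - T y) / norm (x - y) \<le> M)
      \<longleftrightarrow> norm (T x - T y) \<le> M * norm (x - y)"
      by (cases "x = y") (auto simp: divide_le_eq)
  qed
  finally show ?thesis .
qed

section \<open>Descent, tangent and cocoercivity inequalities\<close>

lemma descent_lemma:
  assumes deriv: "\<And>x. GDERIV F x :> T x"
    and lip: "\<And>x y. norm (T x - T y) \<le> M * norm (x - y)"
  shows "F x \<le> F y + T y \<bullet> (x - y) + M / 2 * (norm (x - y))\<^sup>2"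
proof -
  define d where "d = x - y"
  \<comment> \<open>\<open>F\<close> along the segment minus the growth that the bound allows: the
    claim is \<open>u 1 \<le> u 0\<close>, and the Lipschitz bound makes the derivative of
    \<open>u\<close> nonpositive.\<close>
  define u where "u t = F (y + t *\<^sub>R d) - t * (T y \<bullet> d) - M / 2 * t\<^sup>2 * (norm d)\<^sup>2" for t
  have "u 1 \<le> u 0"
  proof (rule DERIV_nonpos_imp_nonincreasing[of 0 1 u])
    fix t :: real assume t: "0 \<le> t" "t \<le> 1"
    let ?D = "d \<bullet> T (y + t *\<^sub>R d) - T y \<bullet> d - M * t * (norm d)\<^sup>2"
    have "DERIV u t :> ?D"
      unfolding u_def
      by (rule derivative_eq_intros gderiv_along_line[OF deriv] refl | simp)+
    moreover have "?D \<le> 0"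
    proof -
      have "d \<bullet> (T (y + t *\<^sub>R d) - T y) \<le> norm d * norm (T (y + t *\<^sub>R d) - T y)"
        by (rule norm_cauchy_schwarz)
      also have "\<dots> \<le> norm d * (M * norm (t *\<^sub>R d))"
        using lip[of "y + t *\<^sub>R d" y] by (intro mult_left_mono) auto
      finally show ?thesis using t by (simp add: inner_diff_right inner_commute power2_eq_square
            algebra_simps)
    qed
    ultimately show "\<exists>D. DERIV u t :> D \<and> D \<le> 0" by blast
  qed simp
  then show ?thesis by (simp add: u_def d_def)
qed

lemma convex_on_gderiv_tangent:
  assumes convex: "convex_on UNIV \<phi>" and deriv: "GDERIV \<phi> y :> p"
  shows "\<phi> z \<ge> \<phi> y + p \<bullet> (z - y)"
proof -
  define u where "u t = \<phi> (y + t *\<^sub>R (z - y))" for t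
  have "convex_on UNIV u"
  proof (rule convex_onI)
    fix t a b :: real assume t: "0 < t" "t < 1"
    have "y + ((1 - t) *\<^sub>R a + t *\<^sub>R b) *\<^sub>R (z - y)
        = (1 - t) *\<^sub>R (y + a *\<^sub>R (z - y)) + t *\<^sub>R (y + b *\<^sub>R (z - y))"
      by (simp add: algebra_simps)
    then show "u ((1 - t) *\<^sub>R a + t *\<^sub>R b) \<le> (1 - t) * u a + t * u b"
      unfolding u_def using convex_onD[OF convex, of t] t by simp
  qed simp
  moreover have "DERIV u 0 :> (z - y) \<bullet> p"
    unfolding u_def using deriv by (intro gderiv_along_line) simp
  ultimately have "u 1 - u 0 \<ge> ((z - y) \<bullet> p) * (1 - 0)"
    by (intro convex_on_imp_above_tangent[of UNIV]) auto
  then show ?thesis by (simp add: u_def inner_commute)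
qed

text \<open>Compare the two bounds at the minimiser \<open>z = x - (p - q) / L\<close> of their difference.\<close>

lemma cocoercive_of_tangent_bounds:
  fixes x y p q :: "'a::real_inner"
  assumes "L > 0"
    and lower: "\<And>z. \<phi> z \<ge> \<phi> y + q \<bullet> (z - y)"
    and upper: "\<And>z. \<phi> z \<le> \<phi> x + p \<bullet> (z - x) + L / 2 * (norm (z - x))\<^sup>2"
  shows "\<phi> x \<ge> \<phi> y + q \<bullet> (x - y) + 1 / (2 * L) * (norm (p - q))\<^sup>2"
proof -
  define z where "z = x - (1 / L) *\<^sub>R (p - q)"
  have "\<phi> y + q \<bullet> (z - y) \<le> \<phi> x + p \<bullet> (z - x) + L / 2 * (norm (z - x))\<^sup>2"
    using lower[of z] upper[of z] by simp
  moreover have "(norm (z - x))\<^sup>2 = (norm (p - q))\<^sup>2 / L\<^sup>2"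
    by (simp add: z_def power_divide)
  then have "L / 2 * (norm (z - x))\<^sup>2 = 1 / (2 * L) * (norm (p - q))\<^sup>2"
    using \<open>L > 0\<close> by (simp add: power2_eq_square)
  moreover have "p \<bullet> (z - x) - q \<bullet> (z - x) = - (1 / L) * (norm (p - q))\<^sup>2"
    by (simp add: z_def power2_norm_eq_inner inner_simps inner_commute algebra_simps)
  moreover have "q \<bullet> (z - y) = q \<bullet> (z - x) + q \<bullet> (x - y)" by (simp add: inner_simps)
  moreover have "1 / L * (norm (p - q))\<^sup>2 = 2 * (1 / (2 * L) * (norm (p - q))\<^sup>2)"
    using \<open>L > 0\<close> by simp
  ultimately show ?thesis by linarith
qed

section \<open>Convex functions with bounded second differences\<close>

text \<open>The one-sided directional derivative \<open>D\<close> of a convex function is sublinear.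
  The second-difference bound forces \<open>D h + D (- h) \<le> 0\<close>, which makes
  \<open>D\<close> linear; continuity makes it bounded, and Riesz supplies \<open>p\<close>.\<close>

lemma convex_on_bounded_second_difference_tangent:
  fixes \<phi> :: "'a::{real_inner, banach} \<Rightarrow> real"
  assumes convex: "convex_on UNIV \<phi>" and cont: "isCont \<phi> x"
    and second: "\<And>h. \<phi> (x + h) + \<phi> (x - h) - 2 * \<phi> x \<le> L * (norm h)\<^sup>2"
  obtains p where "\<And>h. \<phi> x + h \<bullet> p \<le> \<phi> (x + h)"
    and "\<And>h. \<phi> (x + h) \<le> \<phi> x + h \<bullet> p + L * (norm h)\<^sup>2"
proof -
  define q where "q h t = (\<phi> (x + t *\<^sub>R h) - \<phi> x) / t" for h t
  have q_mono: "q h s \<le> q h t" if "0 < s" "s \<le> t" for h s t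
  proof -
    have "x + s *\<^sub>R h = (1 - s / t) *\<^sub>R x + (s / t) *\<^sub>R (x + t *\<^sub>R h)"
      using that by (simp add: algebra_simps)
    then have "\<phi> (x + s *\<^sub>R h) \<le> (1 - s / t) * \<phi> x + (s / t) * \<phi> (x + t *\<^sub>R h)"
      using convex_onD[OF convex, of "s / t"] that by simp
    then have "\<phi> (x + s *\<^sub>R h) - \<phi> x \<le> (s / t) * (\<phi> (x + t *\<^sub>R h) - \<phi> x)"
      by (simp add: algebra_simps)
    then show ?thesis unfolding q_def using that by (simp add: field_simps)
  qed
  \<comment> \<open>The midpoint of \<open>x + t *\<^sub>R h\<close> and
    \<open>x + t *\<^sub>R k\<close> is \<open>x + (t / 2) *\<^sub>R (h + k)\<close>, hence the
    halved step on the left.\<close>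
  have q_subadd: "q (h + k) (t / 2) \<le> q h t + q k t" if "0 < t" for h k t
  proof -
    have "x + (t / 2) *\<^sub>R (h + k) = (1 - 1 / 2) *\<^sub>R (x + t *\<^sub>R h) + (1 / 2) *\<^sub>R (x + t *\<^sub>R k)"
      by (simp add: algebra_simps flip: scaleR_add_left)
    then have "\<phi> (x + (t / 2) *\<^sub>R (h + k)) \<le> (1 - 1 / 2) * \<phi> (x + t *\<^sub>R h) + (1 / 2) * \<phi> (x + t *\<^sub>R k)"
      using convex_onD[OF convex, of "1 / 2"] by simp
    then have "(\<phi> (x + (t / 2) *\<^sub>R (h + k)) - \<phi> x) * 2 / t
        \<le> ((\<phi> (x + t *\<^sub>R h) - \<phi> x) + (\<phi> (x + t *\<^sub>R k) - \<phi> x)) / t"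
      using that by (intro divide_right_mono) simp_all
    then show ?thesis unfolding q_def add_divide_distrib by simp
  qed
  \<comment> \<open>Subadditivity for \<open>h\<close> and \<open>- h\<close> at the common step
    \<open>r\<close>, which is small enough to compare with both \<open>1\<close> and
    \<open>t\<close> by monotonicity. The infimum below is therefore finite.\<close>
  have q_lower: "- q (- h) 1 \<le> q h t" if "0 < t" for h t
  proof -
    define r where "r = min 1 t"
    have r: "0 < r" "r \<le> 1" "r \<le> t" using that by (auto simp: r_def)
    have "q (h + - h) (r / 2) \<le> q h r + q (- h) r" using r by (intro q_subadd)
    moreover have "q (h + - h) (r / 2) = 0" by (simp add: q_def)
    ultimately show ?thesis using q_mono[of r 1 "- h"] q_mono[of r t h] r by linarith
  qed
  \<comment> \<open>As \<open>q h\<close> is nondecreasing, this infimum is the limit at 0 from the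
    right, the directional derivative.\<close>
  define D where "D h = (INF t\<in>{0<..}. q h t)" for h
  have bdd: "bdd_below (q h ` {0<..})" for h 
    by (rule bdd_belowI2[of _ "- q (- h) 1"]) (simp add: q_lower)
  have D_le: "D h \<le> q h t" if "0 < t" for h t
    unfolding D_def using bdd that by (intro cINF_lower) auto
  have D_ge: "a \<le> D h" if "\<And>t. 0 < t \<Longrightarrow> a \<le> q h t" for a h
    unfolding D_def using that by (intro cINF_greatest) auto
  have D_zero: "D 0 = 0" unfolding D_def q_def by (simp add: cINF_const)
  \<comment> \<open>By monotonicity the approximation holds for all smaller steps, so two directions
    can share one step.\<close>
  have D_approx: "\<exists>t0>0. \<forall>t. 0 < t \<and> t \<le> t0 \<longrightarrow> q h t < D h + e" if "e > 0" for h e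
  proof -
    have "(INF t\<in>{0<..}. q h t) < D h + e" unfolding D_def using that by simp
    then obtain t0 where "t0 > 0" "q h t0 < D h + e"
      using bdd by (subst (asm) cINF_less_iff) auto
    then show ?thesis using q_mono by (meson le_less_trans)
  qed
  have D_subadd: "D (h + k) \<le> D h + D k" for h k
  proof (rule field_le_epsilon)
    fix e :: real assume "e > 0"
    then obtain t1 t2 where t: "t1 > 0" "t2 > 0"
      and t1: "\<And>t. 0 < t \<and> t \<le> t1 \<Longrightarrow> q h t < D h + e / 2"
      and t2: "\<And>t. 0 < t \<and> t \<le> t2 \<Longrightarrow> q k t < D k + e / 2"
      using D_approx[of "e / 2" h] D_approx[of "e / 2" k] by auto
    define t where "t = min t1 t2"
    have pos: "t > 0" "t \<le> t1" "t \<le> t2" using t by (auto simp: t_def)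
    have "D (h + k) \<le> q (h + k) (t / 2)" using pos by (intro D_le) simp
    also have "\<dots> \<le> q h t + q k t" using pos by (intro q_subadd)
    finally show "D (h + k) \<le> D h + D k + e" using t1[of t] t2[of t] pos by simp
  qed
  have D_minus: "D (- h) = - D h" for h
  proof (rule antisym)
    have "D h + D (- h) \<le> 0 + e" if "e > 0" for e
    proof -
      \<comment> \<open>The second difference divided by \<open>t\<close> is at most
        \<open>t * (L * (norm h)\<^sup>2)\<close>, which this choice keeps below \<open>e\<close>;
        the \<open>+ 1\<close> keeps the denominator positive.\<close>
      define t where "t = e / (\<bar>L\<bar> * (norm h)\<^sup>2 + 1)"
      have "t > 0" unfolding t_def using that by (intro divide_pos_pos add_nonneg_pos) auto
      have "D h + D (- h) \<le> q h t + q (- h) t" using D_le \<open>t > 0\<close> by (intro add_mono) auto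
      also have "\<dots> = (\<phi> (x + t *\<^sub>R h) + \<phi> (x - t *\<^sub>R h) - 2 * \<phi> x) / t"
        by (simp add: q_def diff_divide_distrib add_divide_distrib)
      also have "\<dots> \<le> (L * (norm (t *\<^sub>R h))\<^sup>2) / t"
        using second[of "t *\<^sub>R h"] \<open>t > 0\<close> by (intro divide_right_mono) auto
      also have "\<dots> = t * (L * (norm h)\<^sup>2)"
        using \<open>t > 0\<close> by (simp add: power_mult_distrib power2_eq_square)
      also have "\<dots> \<le> t * (\<bar>L\<bar> * (norm h)\<^sup>2 + 1)"
        using \<open>t > 0\<close> mult_right_mono[OF abs_ge_self[of L] zero_le_power2[of "norm h"]]
        by (intro mult_left_mono) auto
      also have "\<dots> = e"
      proof -
        have "\<bar>L\<bar> * (norm h)\<^sup>2 + 1 > 0" by (intro add_nonneg_pos) auto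
        then show ?thesis unfolding t_def by simp
      qed
      finally show ?thesis by simp
    qed
    then have "D h + D (- h) \<le> 0" by (rule field_le_epsilon)
    then show "D (- h) \<le> - D h" by simp
    show "- D h \<le> D (- h)" using D_subadd[of h "- h"] D_zero by simp
  qed
  have D_add: "D (h + k) = D h + D k" for h k
    using D_subadd[of h k] D_subadd[of "h + k" "- k"] by (simp add: D_minus)
  have D_scale_le: "D (r *\<^sub>R h) \<le> r * D h" if "r > 0" for r h
  proof -
    have "D (r *\<^sub>R h) / r \<le> D h"
    proof (rule D_ge)
      fix t :: real assume "t > 0"
      have "D (r *\<^sub>R h) \<le> q (r *\<^sub>R h) (t / r)" using \<open>t > 0\<close> that by (intro D_le) simp
      also have "\<dots> = r * q h t" unfolding q_def using that by simp
      finally show "D (r *\<^sub>R h) / r \<le> q h t" using that by (simp add: field_simps)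
    qed
    then show ?thesis using that by (simp add: field_simps)
  qed
  have D_scale_pos: "D (r *\<^sub>R h) = r * D h" if "r > 0" for r h
    using D_scale_le[OF that, of h] D_scale_le[of "1 / r" "r *\<^sub>R h"] that
    by (intro antisym) (simp_all add: field_simps)
  have D_scale: "D (r *\<^sub>R h) = r * D h" for r h
    using D_scale_pos[of r h] D_scale_pos[of "- r" "h"] D_minus[of "r *\<^sub>R h"] D_zero
    by (cases r "0::real" rule: linorder_cases) auto
  obtain \<delta> where \<delta>: "\<delta> > 0" "\<And>y. dist y x < \<delta> \<Longrightarrow> dist (\<phi> y) (\<phi> x) < 1"
    using cont zero_less_one unfolding continuous_at_eps_delta by metis
  have D_small: "D h \<le> norm h * (2 / \<delta>)" for h
  proof (cases "h = 0")
    case False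
    \<comment> \<open>Scales \<open>h\<close> to norm \<open>\<delta> / 2\<close>, where continuity
      bounds the increment of \<open>\<phi>\<close> by 1; homogeneity of \<open>D\<close> carries
      the bound back to \<open>h\<close>.\<close>
    define r where "r = \<delta> / (2 * norm h)"
    have "r > 0" using False \<delta>(1) by (simp add: r_def)
    have "norm (r *\<^sub>R h) < \<delta>" using False \<delta>(1) by (simp add: r_def)
    then have "q (r *\<^sub>R h) 1 \<le> 1" using \<delta>(2)[of "x + r *\<^sub>R h"] by (simp add: q_def dist_norm)
    then have "r * D h \<le> 1" using D_le[of 1 "r *\<^sub>R h"] by (simp add: D_scale)
    then show ?thesis using False \<delta>(1) by (simp add: r_def field_simps)
  qed (simp add: D_zero)
  have "bounded_linear D"
  proof (rule bounded_linear_intro)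
    show "norm (D h) \<le> norm h * (2 / \<delta>)" for h
      using D_small[of h] D_small[of "- h"] by (simp add: D_minus abs_le_iff)
  qed (auto simp: D_add D_scale)
  then obtain p where p: "\<And>h. D h = h \<bullet> p" by (rule riesz_representation) blast
  have lower: "\<phi> x + h \<bullet> p \<le> \<phi> (x + h)" for h
    using D_le[of 1 h] by (simp add: q_def p)
  \<comment> \<open>The tangent bound at \<open>- h\<close> is inserted into the second difference,
    which loses a factor 2 against the optimal constant \<open>L / 2\<close>.\<close>
  moreover have "\<phi> (x + h) \<le> \<phi> x + h \<bullet> p + L * (norm h)\<^sup>2" for h
    using lower[of "- h"] second[of h] by simp
  ultimately show ?thesis by (rule that)
qed

text \<open>A bound \<open>a \<parallel>h\<parallel>\<^sup>2\<close> on the remainder improves to \<open>(a / 2 + L / 4) \<parallel>h\<parallel>\<^sup>2\<close> by applying it to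
  \<open>h / 2\<close>; the fixed point of this iteration is \<open>L / 2\<close>.\<close>

lemma bounded_second_difference_sharp_bound:
  fixes \<phi> :: "'a::real_inner \<Rightarrow> real"
  assumes second: "\<And>x h. \<phi> (x + h) + \<phi> (x - h) - 2 * \<phi> x \<le> L * (norm h)\<^sup>2"
    and upper: "\<And>h. \<phi> (x + h) \<le> \<phi> x + h \<bullet> p + L * (norm h)\<^sup>2"
  shows "\<phi> (x + h) \<le> \<phi> x + h \<bullet> p + L / 2 * (norm h)\<^sup>2"
proof -
  define e where "e h = \<phi> (x + h) - \<phi> x - h \<bullet> p" for h
  \<comment> \<open>Second difference centred at \<open>x + (1/2) *\<^sub>R h\<close> with end
    points \<open>x\<close> and \<open>x + h\<close>; the linear terms cancel and
    \<open>e 0 = 0\<close>.\<close>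
  have halve: "e h \<le> 2 * e ((1/2) *\<^sub>R h) + L / 4 * (norm h)\<^sup>2" for h
  proof -
    have mid: "x + (1/2) *\<^sub>R h + (1/2) *\<^sub>R h = x + h" by (simp add: add.assoc flip: scaleR_add_left)
    show ?thesis using second[of "x + (1/2) *\<^sub>R h" "(1/2) *\<^sub>R h", unfolded mid]
      by (simp add: e_def power_divide)
  qed
  have iter: "e h \<le> (L / 2 + L / 2 * (1/2) ^ n) * (norm h)\<^sup>2" for n h
  proof (induction n arbitrary: h)
    case 0
    then show ?case using upper[of h] by (simp add: e_def)
  next
    case (Suc n)
    have "e h \<le> 2 * ((L / 2 + L / 2 * (1/2) ^ n) * (norm ((1/2) *\<^sub>R h))\<^sup>2) + L / 4 * (norm h)\<^sup>2"
      using halve[of h] Suc[of "(1/2) *\<^sub>R h"] by linarith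
    also have "\<dots> = (L / 2 + L / 2 * (1/2) ^ Suc n) * (norm h)\<^sup>2"
      by (simp add: power_divide algebra_simps)
    finally show ?case .
  qed
  have "(\<lambda>n. (L / 2 + L / 2 * (1/2) ^ n) * (norm h)\<^sup>2) \<longlonglongrightarrow> (L / 2 + L / 2 * 0) * (norm h)\<^sup>2"
    by (intro tendsto_intros LIMSEQ_power_zero) simp
  then have "e h \<le> (L / 2 + L / 2 * 0) * (norm h)\<^sup>2"
    by (rule LIMSEQ_le_const) (use iter in blast)
  then show ?thesis by (simp add: e_def)
qed

section \<open>The convex envelope\<close>

lemma lower_semicont_ereal:
  assumes "\<And>x. isCont h x"
  shows "lower_semicont (\<lambda>x. ereal (h x))"
  unfolding lower_semicont_def le_Liminf_iff
proof (intro allI impI)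
  fix x y assume "y < ereal (h x)"
  moreover have "((\<lambda>x. ereal (h x)) \<longlongrightarrow> ereal (h x)) (at x)"
    using assms by (simp add: isCont_def)
  ultimately show "\<forall>\<^sub>F x in at x. y < ereal (h x)" by (rule order_tendstoD(1)[rotated])
qed

lemma ereal_convex_ereal_iff:
  "ereal_convex (\<lambda>x. ereal (h x)) \<longleftrightarrow> convex_on UNIV h"
proof
  assume "ereal_convex (\<lambda>x. ereal (h x))"
  then show "convex_on UNIV h"
    unfolding ereal_convex_def by (intro convex_onI) auto
next
  assume h: "convex_on UNIV h"
  show "ereal_convex (\<lambda>x. ereal (h x))"
    unfolding ereal_convex_def using convex_onD[OF h] by auto
qed

lemma ereal_convex_SUP:
  assumes "\<And>h. h \<in> S \<Longrightarrow> ereal_convex h"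
  shows "ereal_convex (\<lambda>x. SUP h\<in>S. h x)"
  unfolding ereal_convex_def
proof (intro allI ballI SUP_least)
  fix x y t h assume t: "t \<in> {0..1::real}" and "h \<in> S"
  then have "h ((1 - t) *\<^sub>R x + t *\<^sub>R y) \<le> ereal (1 - t) * h x + ereal t * h y"
    using assms unfolding ereal_convex_def by blast
  also have "\<dots> \<le> ereal (1 - t) * (SUP h\<in>S. h x) + ereal t * (SUP h\<in>S. h y)"
    using t by (intro add_mono ereal_mult_left_mono SUP_upper \<open>h \<in> S\<close>) auto
  finally show "h ((1 - t) *\<^sub>R x + t *\<^sub>R y)
      \<le> ereal (1 - t) * (SUP h\<in>S. h x) + ereal t * (SUP h\<in>S. h y)" .
qed

text \<open>The gateway for competitors: tangents, averaged translates and other extensions are all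
  compared with the envelope through this bound.\<close>

lemma conv_envelope_upper:
  assumes "convex_on UNIV h" "\<And>x. isCont h x" "\<And>x. ereal (h x) \<le> g x"
  shows "ereal (h x) \<le> conv_envelope g x"
  unfolding conv_envelope_def
proof (rule SUP_upper2[of "\<lambda>x. ereal (h x)"])
  show "(\<lambda>x. ereal (h x)) \<in> {h. ereal_convex h \<and> ereal_proper h \<and> lower_semicont h \<and> h \<le> g}"
    using assms lower_semicont_ereal[OF assms(2)]
    by (simp add: ereal_convex_ereal_iff ereal_proper_def le_fun_def)
qed simp

lemma conv_envelope_le: "conv_envelope g x \<le> g x"
  unfolding conv_envelope_def by (intro SUP_least) (auto simp: le_fun_def)

lemma ereal_convex_conv_envelope: "ereal_convex (conv_envelope g)"
  unfolding conv_envelope_def[abs_def] by (intro ereal_convex_SUP) auto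

text \<open>The minorant \<open>m\<close> keeps the envelope above \<open>-\<infinity>\<close>, and
  \<open>g\<close> keeps it below \<open>\<infinity>\<close>.\<close>

lemma conv_envelope_real:
  assumes "convex_on UNIV m" "\<And>x. isCont m x" "\<And>x. ereal (m x) \<le> g x" "\<And>x. g x \<noteq> \<infinity>"
  obtains \<phi> where "\<And>x. conv_envelope g x = ereal (\<phi> x)" "convex_on UNIV \<phi>"
proof -
  have finite: "\<bar>conv_envelope g x\<bar> \<noteq> \<infinity>" for x
    using conv_envelope_upper[OF assms(1-3), of x] conv_envelope_le[of g x] assms(4)[of x] by auto
  define \<phi> where "\<phi> x = real_of_ereal (conv_envelope g x)" for x
  have \<phi>: "conv_envelope g x = ereal (\<phi> x)" for x
    using finite[of x] by (simp add: \<phi>_def ereal_real')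
  then have "conv_envelope g = (\<lambda>x. ereal (\<phi> x))" by auto
  then have "convex_on UNIV \<phi>"
    using ereal_convex_conv_envelope[of g] by (simp add: ereal_convex_ereal_iff)
  with \<phi> show ?thesis using that by blast
qed

text \<open>In infinite dimensions a finite convex function may be discontinuous; \<open>l\<close>
  and \<open>u\<close> supply the local boundedness that yields continuity.\<close>

lemma convex_on_between_isCont:
  fixes \<phi> :: "'a::real_normed_vector \<Rightarrow> real"
  assumes convex: "convex_on UNIV \<phi>" and "isCont l x" "isCont u x"
    and bounds: "\<And>z. l z \<le> \<phi> z" "\<And>z. \<phi> z \<le> u z"
  shows "isCont \<phi> x"
proof -
  obtain d1 where d1: "d1 > 0" "\<And>y. dist y x < d1 \<Longrightarrow> dist (l y) (l x) < 1"
    using assms(2) zero_less_one unfolding continuous_at_eps_delta by metis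
  obtain d2 where d2: "d2 > 0" "\<And>y. dist y x < d2 \<Longrightarrow> dist (u y) (u x) < 1"
    using assms(3) zero_less_one unfolding continuous_at_eps_delta by metis
  let ?B = "ball x (min d1 d2)"
  have "continuous_on ?B \<phi>"
  proof (rule convex_on_bounded_continuous)
    show "\<forall>y\<in>?B. \<bar>\<phi> y\<bar> \<le> \<bar>l x\<bar> + \<bar>u x\<bar> + 1"
    proof
      fix y assume "y \<in> ?B"
      then have "dist (l y) (l x) < 1" "dist (u y) (u x) < 1"
        using d1(2)[of y] d2(2)[of y] by (auto simp: dist_commute)
      then show "\<bar>\<phi> y\<bar> \<le> \<bar>l x\<bar> + \<bar>u x\<bar> + 1" using bounds[of y] by (simp add: dist_real_def)
    qed
  qed (auto intro: convex_on_subset[OF convex])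
  moreover have "x \<in> ?B" using d1(1) d2(1) by simp
  ultimately show ?thesis using continuous_on_eq_continuous_at[OF open_ball] by blast
qed

text \<open>The average of the translates of the envelope by \<open>h\<close> and \<open>- h\<close>, lowered by
  \<open>L / 2 \<parallel>h\<parallel>\<^sup>2\<close>, is itself a convex minorant of \<open>g\<close>, hence lies below the envelope.\<close>

lemma conv_envelope_second_difference:
  fixes g :: "'a::real_normed_vector \<Rightarrow> ereal"
  assumes env: "\<And>x. conv_envelope g x = ereal (\<phi> x)" and convex: "convex_on UNIV \<phi>"
    and cont: "\<And>x. isCont \<phi> x"
    and g: "\<And>x a b. ereal a \<le> g (x + h) \<Longrightarrow> ereal b \<le> g (x - h)
      \<Longrightarrow> ereal ((a + b) / 2 - L / 2 * (norm h)\<^sup>2) \<le> g x"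
  shows "\<phi> (x + h) + \<phi> (x - h) - 2 * \<phi> x \<le> L * (norm h)\<^sup>2"
proof -
  define K where "K x = (\<phi> (x + h) + \<phi> (x - h)) / 2 - L / 2 * (norm h)\<^sup>2" for x
  have "convex_on UNIV K"
  proof (rule convex_onI)
    fix t :: real and x y assume t: "0 < t" "t < 1"
    have "(1 - t) *\<^sub>R x + t *\<^sub>R y + h = (1 - t) *\<^sub>R (x + h) + t *\<^sub>R (y + h)"
      "(1 - t) *\<^sub>R x + t *\<^sub>R y - h = (1 - t) *\<^sub>R (x - h) + t *\<^sub>R (y - h)"
      by (simp_all add: algebra_simps)
    then have "\<phi> ((1 - t) *\<^sub>R x + t *\<^sub>R y + h) \<le> (1 - t) * \<phi> (x + h) + t * \<phi> (y + h)"
      "\<phi> ((1 - t) *\<^sub>R x + t *\<^sub>R y - h) \<le> (1 - t) * \<phi> (x - h) + t * \<phi> (y - h)"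
      using convex_onD[OF convex, of t] t by simp_all
    then show "K ((1 - t) *\<^sub>R x + t *\<^sub>R y) \<le> (1 - t) * K x + t * K y"
      unfolding K_def by (simp add: field_simps)
  qed simp
  moreover have "isCont K x" for x
    unfolding K_def
    by (intro continuous_intros isCont_o2[OF _ cont]) simp_all
  moreover have "ereal (K x) \<le> g x" for x
    unfolding K_def
    using conv_envelope_le[of g "x + h"] conv_envelope_le[of g "x - h"] by (intro g) (simp_all add: env)
  ultimately have "ereal (K x) \<le> conv_envelope g x" by (rule conv_envelope_upper)
  then show ?thesis by (simp add: env K_def field_simps)
qed

section \<open>Jets and their extensions\<close>

text \<open>Expanding the square of \<open>u - c *\<^sub>R d\<close>, with \<open>d = x - y\<close>
  and \<open>u = G x - G y\<close>, explains the coefficients: the cross term gives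
  \<open>c / (M - c)\<close>, and the \<open>d\<close> terms add up to
  \<open>c / 2 + c\<^sup>2 / (2 * (M - c)) = c * M / (2 * (M - c))\<close>.\<close>

lemma SCW11_shift:
  assumes "M > c"
  shows "SCW11 c M E f G \<longleftrightarrow>
    SCW11 0 (M - c) E (\<lambda>x. f x - c / 2 * (norm x)\<^sup>2) (\<lambda>x. G x - c *\<^sub>R x)"
proof -
  have eq: "f y + G y \<bullet> (x - y) + c / (M - c) * ((G x - G y) \<bullet> (y - x))
        + c * M / (2 * (M - c)) * (norm (x - y))\<^sup>2 + 1 / (2 * (M - c)) * (norm (G x - G y))\<^sup>2
      = (f y - c / 2 * (norm y)\<^sup>2) + (G y - c *\<^sub>R y) \<bullet> (x - y)
        + 1 / (2 * (M - c)) * (norm ((G x - c *\<^sub>R x) - (G y - c *\<^sub>R y)))\<^sup>2 + c / 2 * (norm x)\<^sup>2"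
    for x y
  proof -
    define d u where "d = x - y" and "u = G x - G y"
    have eq: "(G x - c *\<^sub>R x) - (G y - c *\<^sub>R y) = u - c *\<^sub>R d"
      by (simp add: d_def u_def algebra_simps)
    have 1: "(norm ((G x - c *\<^sub>R x) - (G y - c *\<^sub>R y)))\<^sup>2
        = (norm u)\<^sup>2 - 2 * c * (u \<bullet> d) + c\<^sup>2 * (norm d)\<^sup>2"
      unfolding power2_norm_eq_inner eq
      by (simp add: inner_diff_left inner_diff_right inner_commute[of d u] power2_eq_square
          algebra_simps)
    have 2: "(norm x)\<^sup>2 = (norm y)\<^sup>2 + 2 * (y \<bullet> d) + (norm d)\<^sup>2"
      by (simp add: d_def power2_norm_eq_inner inner_diff_left inner_diff_right inner_commute[of x y])
    have 3: "u \<bullet> (y - x) = - (u \<bullet> d)" by (simp add: d_def inner_diff_right)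
    obtain L where L: "L > 0" "M = L + c" using assms by (metis diff_add_cancel diff_gt_0_iff_gt)
    have 4: "c * M / (2 * (M - c)) = c / 2 + c\<^sup>2 / (2 * (M - c))"
      "c / (M - c) = 2 * c / (2 * (M - c))"
      using L(1) by (simp_all add: L(2) field_simps power2_eq_square)
    show ?thesis
      unfolding 1 2 4 d_def[symmetric] u_def[symmetric] 3 inner_diff_left inner_scaleR_left
      by (simp add: ring_distribs add_divide_distrib diff_divide_distrib)
  qed
  show ?thesis unfolding SCW11_def eq by (simp add: algebra_simps)
qed

lemma paraboloid_shift:
  fixes x y T :: "'a::real_inner"
  shows "b - c / 2 * (norm y)\<^sup>2 + (T - c *\<^sub>R y) \<bullet> (x - y) + (M - c) / 2 * (norm (x - y))\<^sup>2
    = b + T \<bullet> (x - y) + M / 2 * (norm (x - y))\<^sup>2 - c / 2 * (norm x)\<^sup>2"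
  unfolding power2_norm_eq_inner
  by (simp add: inner_diff_left inner_diff_right inner_commute[of y x] algebra_simps
      diff_divide_distrib add_divide_distrib)

text \<open>Describing the infimum by its real lower bounds avoids arithmetic with a possible value
  \<open>-\<infinity>\<close>.\<close>

lemma le_jet_inf_iff:
  "ereal a \<le> jet_inf c M E f G x \<longleftrightarrow>
    (\<forall>y\<in>E. a \<le> f y - c / 2 * (norm y)\<^sup>2 + (G y - c *\<^sub>R y) \<bullet> (x - y)
      + (M - c) / 2 * (norm (x - y))\<^sup>2)"
proof -
  have "ereal a \<le> I - ereal b \<longleftrightarrow> ereal (a + b) \<le> I" for I b
    by (cases I) auto
  then show ?thesis unfolding jet_inf_def paraboloid_shift by (simp add: le_INF_iff le_diff_eq)
qed

section \<open>Extension of a jet in the case c = 0\<close>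

lemma SCW11_convexD:
  assumes "SCW11 0 L E f G" "x \<in> E" "y \<in> E"
  shows "f y + G y \<bullet> (x - y) + 1 / (2 * L) * (norm (G x - G y))\<^sup>2 \<le> f x"
  using assms(1)[unfolded SCW11_def, rule_format, OF assms(2,3)] by simp

text \<open>By the condition at \<open>z\<close> and \<open>y\<close>, the paraboloid exceeds the
  tangent by at least \<open>1 / (2 * L) * (norm (u + L *\<^sub>R d))\<^sup>2\<close>; the gradient
  term of the condition is exactly what completes this square.\<close>

lemma tangent_le_jet_paraboloid:
  assumes scw: "SCW11 0 L E f G" and "L > 0" and "y \<in> E" "z \<in> E"
  shows "f y + G y \<bullet> (x - y) \<le> f z + G z \<bullet> (x - z) + L / 2 * (norm (x - z))\<^sup>2"
proof -
  define d u where "d = x - z" and "u = G z - G y"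
  have "0 \<le> 1 / (2 * L) * (norm (u + L *\<^sub>R d))\<^sup>2" using \<open>L > 0\<close> by simp
  also have "(norm (u + L *\<^sub>R d))\<^sup>2 = (norm u)\<^sup>2 + 2 * L * (u \<bullet> d) + L\<^sup>2 * (norm d)\<^sup>2"
    unfolding power2_norm_eq_inner
    by (simp add: inner_left_distrib inner_right_distrib inner_commute[of d u] power2_eq_square
        algebra_simps)
  also have "1 / (2 * L) * \<dots> = 1 / (2 * L) * (norm u)\<^sup>2 + u \<bullet> d + L / 2 * (norm d)\<^sup>2"
    using \<open>L > 0\<close> by (simp add: field_simps power2_eq_square)
  finally have "0 \<le> 1 / (2 * L) * (norm u)\<^sup>2 + u \<bullet> d + L / 2 * (norm d)\<^sup>2" .
  moreover have "u \<bullet> d = G z \<bullet> (x - z) - G y \<bullet> (x - y) + G y \<bullet> (z - y)"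
    by (simp add: u_def d_def inner_diff_left inner_diff_right)
  ultimately show ?thesis
    using SCW11_convexD[OF scw \<open>z \<in> E\<close> \<open>y \<in> E\<close>] unfolding u_def d_def by linarith
qed

text \<open>The case \<open>c = 0\<close>; the assumption on \<open>g\<close> says that it is the infimum of the paraboloids.\<close>

lemma conv_envelope_extends_convex_jet:
  fixes E :: "'a::{real_inner, banach} set" and g :: "'a \<Rightarrow> ereal"
  assumes "E \<noteq> {}" "L > 0" and scw: "SCW11 0 L E f G"
    and g: "\<And>a x. ereal a \<le> g x \<longleftrightarrow>
      (\<forall>y\<in>E. a \<le> f y + G y \<bullet> (x - y) + L / 2 * (norm (x - y))\<^sup>2)"
  obtains \<phi> p where "\<And>x. conv_envelope g x = ereal (\<phi> x)" "convex_on UNIV \<phi>"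
    "\<And>x. GDERIV \<phi> x :> p x"
    "\<And>x z. \<phi> z \<le> \<phi> x + p x \<bullet> (z - x) + L / 2 * (norm (z - x))\<^sup>2"
    "\<And>y. y \<in> E \<Longrightarrow> \<phi> y = f y \<and> p y = G y"
proof -
  define l where "l y x = f y + G y \<bullet> (x - y)" for x y
  define u where "u y x = l y x + L / 2 * (norm (x - y))\<^sup>2" for x y
  obtain y0 where y0: "y0 \<in> E" using \<open>E \<noteq> {}\<close> by blast
  have l_convex: "convex_on UNIV (l y)" for y
  proof (rule convex_onI)
    show "l y ((1 - t) *\<^sub>R a + t *\<^sub>R b) \<le> (1 - t) * l y a + t * l y b" for t a b
      unfolding l_def by (simp add: inner_diff_right inner_right_distrib algebra_simps)
  qed simp
  have l_cont: "isCont (l y) x" for x y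
    unfolding l_def by (intro continuous_intros)
  have u_cont: "isCont (u y) x" for x y
    unfolding u_def by (intro continuous_intros l_cont)
  have l_le_g: "ereal (l y x) \<le> g x" if "y \<in> E" for x y
    unfolding g l_def using tangent_le_jet_paraboloid[OF scw \<open>L > 0\<close> that] by blast
  have g_le_u: "a \<le> u y x" if "y \<in> E" "ereal a \<le> g x" for a x y
    using that unfolding g u_def l_def by blast
  have "g x \<noteq> \<infinity>" for x
  proof
    assume "g x = \<infinity>"
    then have "ereal (u y0 x + 1) \<le> g x" by simp
    from g_le_u[OF y0 this] show False by simp
  qed
  then obtain \<phi> where env: "\<And>x. conv_envelope g x = ereal (\<phi> x)" and convex: "convex_on UNIV \<phi>"
    using conv_envelope_real[OF l_convex l_cont l_le_g[OF y0]] by metis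
  have lower: "l y x \<le> \<phi> x" if "y \<in> E" for x y
    using conv_envelope_upper[OF l_convex l_cont l_le_g[OF that]] by (simp add: env)
  have upper: "\<phi> x \<le> u y x" if "y \<in> E" for x y
    using conv_envelope_le[of g x] that by (intro g_le_u) (simp_all add: env)
  have cont: "isCont \<phi> x" for x
    using convex_on_between_isCont[OF convex l_cont u_cont] lower[OF y0] upper[OF y0] by blast
  have second: "\<phi> (x + h) + \<phi> (x - h) - 2 * \<phi> x \<le> L * (norm h)\<^sup>2" for x h
  proof (rule conv_envelope_second_difference[OF env convex cont])
    fix x a b assume a: "ereal a \<le> g (x + h)" and b: "ereal b \<le> g (x - h)"
    show "ereal ((a + b) / 2 - L / 2 * (norm h)\<^sup>2) \<le> g x"
      unfolding g
    proof
      fix y assume "y \<in> E"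
      \<comment> \<open>Each paraboloid attains the second-difference bound with equality, so the
        averaged lower bounds pass to the infimum.\<close>
      have "u y (x + h) + u y (x - h) = 2 * u y x + L * (norm h)\<^sup>2"
        unfolding u_def l_def power2_norm_eq_inner
        by (simp add: inner_diff_left inner_diff_right inner_left_distrib inner_right_distrib
            algebra_simps)
      then show "(a + b) / 2 - L / 2 * (norm h)\<^sup>2
          \<le> f y + G y \<bullet> (x - y) + L / 2 * (norm (x - y))\<^sup>2"
        using g_le_u[OF \<open>y \<in> E\<close> a] g_le_u[OF \<open>y \<in> E\<close> b] unfolding u_def l_def by argo
    qed
  qed
  have "\<exists>p. (\<forall>h. \<phi> x + h \<bullet> p \<le> \<phi> (x + h)) \<and> (\<forall>h. \<phi> (x + h) \<le> \<phi> x + h \<bullet> p + L * (norm h)\<^sup>2)"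
    for x
    by (rule convex_on_bounded_second_difference_tangent[OF convex cont second]) blast
  then obtain p where p_lower: "\<And>x h. \<phi> x + h \<bullet> p x \<le> \<phi> (x + h)"
    and p_upper: "\<And>x h. \<phi> (x + h) \<le> \<phi> x + h \<bullet> p x + L * (norm h)\<^sup>2" by metis
  have p_sharp: "\<phi> (x + h) \<le> \<phi> x + h \<bullet> p x + L / 2 * (norm h)\<^sup>2" for x h
    by (rule bounded_second_difference_sharp_bound[OF second p_upper])
  have deriv: "GDERIV \<phi> x :> p x" for x
  proof (rule gderiv_quadratic_error)
    show "\<bar>\<phi> (x + h) - \<phi> x - h \<bullet> p x\<bar> \<le> L / 2 * (norm h)\<^sup>2" for h
      using p_lower[of x h] p_sharp[of x h] by linarith
  qed
  have jet: "\<phi> y = f y \<and> p y = G y" if "y \<in> E" for y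
  proof -
    have val: "\<phi> y = f y" using lower[OF that, of y] upper[OF that, of y] by (simp add: u_def l_def)
    \<comment> \<open>\<open>l y\<close> and \<open>u y\<close> share value and slope at
      \<open>y\<close>, so \<open>\<phi>\<close>, squeezed between them, has gradient
      \<open>G y\<close> there; uniqueness of the gradient gives \<open>p y = G y\<close>.\<close>
    have "GDERIV \<phi> y :> G y"
    proof (rule gderiv_quadratic_error)
      fix h
      show "\<bar>\<phi> (y + h) - \<phi> y - h \<bullet> G y\<bar> \<le> L / 2 * (norm h)\<^sup>2"
        using lower[OF that, of "y + h"] upper[OF that, of "y + h"]
        by (simp add: val u_def l_def inner_commute abs_le_iff)
    qed
    then show ?thesis using val deriv grad_eqI by metis
  qed
  show ?thesis
  proof (rule that[OF env convex deriv])
    show "\<phi> z \<le> \<phi> x + p x \<bullet> (z - x) + L / 2 * (norm (z - x))\<^sup>2" for x z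
      using p_sharp[of x "z - x"] by (simp add: inner_commute)
  qed (use jet in auto)
qed

text \<open>Cocoercivity bounds the squared left side by
  \<open>(L + 2 * c) * (u \<bullet> d) + c\<^sup>2 * (norm d)\<^sup>2\<close>. The sign of
  \<open>L + 2 * c\<close> permits replacing \<open>u \<bullet> d\<close> by its bound
  \<open>L * (norm d)\<^sup>2\<close>, which gives a perfect square. For \<open>L = M - c\<close>
  the sign condition reads \<open>- M \<le> c\<close>.\<close>

lemma cocoercive_shift_lipschitz:
  fixes u d :: "'a::real_inner"
  assumes "L > 0" "L + 2 * c \<ge> 0" and coco: "(norm u)\<^sup>2 \<le> L * (u \<bullet> d)"
  shows "norm (u + c *\<^sub>R d) \<le> (L + c) * norm d"
proof (rule power2_le_imp_le)
  have "(norm u)\<^sup>2 \<le> L * (norm u * norm d)"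
    using coco mult_left_mono[OF norm_cauchy_schwarz[of u d], of L] \<open>L > 0\<close> by linarith
  then have "norm u \<le> L * norm d"
    by (cases "u = 0") (use \<open>L > 0\<close> in \<open>auto simp: power2_eq_square\<close>)
  then have "u \<bullet> d \<le> L * norm d * norm d"
    using norm_cauchy_schwarz[of u d] mult_right_mono[of "norm u" "L * norm d" "norm d"] by simp
  then have "(L + 2 * c) * (u \<bullet> d) \<le> (L + 2 * c) * (L * (norm d)\<^sup>2)"
    using assms(2) by (intro mult_left_mono) (simp_all add: power2_eq_square)
  moreover have "(norm (u + c *\<^sub>R d))\<^sup>2 = (norm u)\<^sup>2 + 2 * c * (u \<bullet> d) + c\<^sup>2 * (norm d)\<^sup>2"
    unfolding power2_norm_eq_inner
    by (simp add: inner_left_distrib inner_right_distrib inner_commute[of d u] power2_eq_square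
        algebra_simps)
  ultimately have "(norm (u + c *\<^sub>R d))\<^sup>2 \<le> (L + 2 * c) * (L * (norm d)\<^sup>2) + c\<^sup>2 * (norm d)\<^sup>2"
    using coco by (simp add: distrib_right)
  then show "(norm (u + c *\<^sub>R d))\<^sup>2 \<le> ((L + c) * norm d)\<^sup>2"
    by (simp add: power2_eq_square algebra_simps)
  show "0 \<le> (L + c) * norm d" using assms(1,2) by simp
qed

section \<open>Extensions and the condition for general c\<close>

lemma C11_upper_paraboloid:
  fixes F :: "'a::{real_inner, banach} \<Rightarrow> real"
  assumes "C11 F" "Lip (grad F) \<le> ennreal M" "M > 0"
  shows "F x - c / 2 * (norm x)\<^sup>2 \<le> (F y - c / 2 * (norm y)\<^sup>2) + (grad F y - c *\<^sub>R y) \<bullet> (x - y)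
      + (M - c) / 2 * (norm (x - y))\<^sup>2"
proof -
  have "F x \<le> F y + grad F y \<bullet> (x - y) + M / 2 * (norm (x - y))\<^sup>2"
    using assms by (intro descent_lemma gderiv_grad) (auto simp: C11_def Lip_le_iff)
  then show ?thesis unfolding paraboloid_shift by simp
qed

text \<open>After the shift the extension lies above its tangents and below its paraboloids of
  curvature \<open>M - c\<close>; cocoercivity is then the condition for
  \<open>c = 0\<close>.\<close>

lemma SCW11_of_extension:
  fixes F :: "'a::{real_inner, banach} \<Rightarrow> real"
  assumes "M > 0" "M > c" and C11: "C11 F" and ext: "extends_jet E f G F"
    and lip: "Lip (grad F) \<le> ennreal M"
    and convex: "convex_on UNIV (\<lambda>x. F x - c / 2 * (norm x)\<^sup>2)"
  shows "SCW11 c M E f G"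
proof -
  have deriv: "GDERIV (\<lambda>x. F x - c / 2 * (norm x)\<^sup>2) x :> grad F x - c *\<^sub>R x" for x
    using C11 by (intro GDERIV_diff gderiv_grad gderiv_half_norm_squared) (simp add: C11_def)
  have "F x - c / 2 * (norm x)\<^sup>2 \<ge> (F y - c / 2 * (norm y)\<^sup>2) + (grad F y - c *\<^sub>R y) \<bullet> (x - y)
      + 1 / (2 * (M - c)) * (norm ((grad F x - c *\<^sub>R x) - (grad F y - c *\<^sub>R y)))\<^sup>2" for x y
    using \<open>M > c\<close> convex_on_gderiv_tangent[OF convex deriv] C11_upper_paraboloid[OF C11 lip \<open>M > 0\<close>]
    by (intro cocoercive_of_tangent_bounds[where \<phi> = "\<lambda>x. F x - c / 2 * (norm x)\<^sup>2"]) auto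
  moreover have "f x = F x" "G x = grad F x" if "x \<in> E" for x
    using ext that by (simp_all add: extends_jet_def)
  ultimately have "SCW11 0 (M - c) E (\<lambda>x. f x - c / 2 * (norm x)\<^sup>2) (\<lambda>x. G x - c *\<^sub>R x)"
    unfolding SCW11_def by simp
  then show ?thesis using SCW11_shift[OF \<open>M > c\<close>] by blast
qed

lemma extension_of_SCW11:
  fixes E :: "'a::{real_inner, banach} set"
  assumes "E \<noteq> {}" "M > 0" "M > c" and scw: "SCW11 c M E f G"
  obtains F where
    "\<And>x. ereal (F x) = conv_envelope (jet_inf c M E f G) x + ereal (c / 2 * (norm x)\<^sup>2)"
    "C11 F" "extends_jet E f G F" "- M \<le> c \<Longrightarrow> Lip (grad F) \<le> ennreal M"
    "convex_on UNIV (\<lambda>x. F x - c / 2 * (norm x)\<^sup>2)"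
proof -
  define L where "L = M - c"
  have "L > 0" using \<open>M > c\<close> by (simp add: L_def)
  obtain \<phi> p where env: "\<And>x. conv_envelope (jet_inf c M E f G) x = ereal (\<phi> x)"
    and convex: "convex_on UNIV \<phi>"
    and deriv: "\<And>x. GDERIV \<phi> x :> p x"
    and upper: "\<And>x z. \<phi> z \<le> \<phi> x + p x \<bullet> (z - x) + L / 2 * (norm (z - x))\<^sup>2"
    and jet: "\<And>y. y \<in> E \<Longrightarrow> \<phi> y = f y - c / 2 * (norm y)\<^sup>2 \<and> p y = G y - c *\<^sub>R y"
    using conv_envelope_extends_convex_jet[OF \<open>E \<noteq> {}\<close> \<open>L > 0\<close>
        scw[unfolded SCW11_shift[OF \<open>M > c\<close>], folded L_def] le_jet_inf_iff[of _ c M E f G, folded L_def]]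
    by blast
  have coco: "(norm (p x - p y))\<^sup>2 \<le> L * ((p x - p y) \<bullet> (x - y))" for x y
  proof -
    have half: "\<phi> y + p y \<bullet> (x - y) + 1 / (2 * L) * (norm (p x - p y))\<^sup>2 \<le> \<phi> x" for x y
      by (rule cocoercive_of_tangent_bounds[OF \<open>L > 0\<close> convex_on_gderiv_tangent[OF convex deriv] upper])
    \<comment> \<open>Adding \<open>half\<close> for \<open>(x, y)\<close> and \<open>(y, x)\<close>
      cancels the values of \<open>\<phi>\<close>.\<close>
    have "1 / L * (norm (p x - p y))\<^sup>2 = 2 * (1 / (2 * L) * (norm (p x - p y))\<^sup>2)"
      by simp
    also have "\<dots> \<le> (p x - p y) \<bullet> (x - y)"
      using half[of x y] half[of y x]
      by (simp add: norm_minus_commute[of "p y"] inner_diff_left inner_diff_right)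
    finally show ?thesis using \<open>L > 0\<close> by (simp add: field_simps)
  qed
  define F where "F x = \<phi> x + c / 2 * (norm x)\<^sup>2" for x
  have F_deriv: "GDERIV F x :> p x + c *\<^sub>R x" for x
    unfolding F_def[abs_def] by (intro GDERIV_add deriv gderiv_half_norm_squared)
  have grad_F: "grad F x = p x + c *\<^sub>R x" for x using F_deriv by (rule grad_eqI)
  have grad_diff: "grad F x - grad F y = (p x - p y) + c *\<^sub>R (x - y)" for x y
    by (simp add: grad_F algebra_simps)
  show ?thesis
  proof (rule that[of F])
    show "ereal (F x) = conv_envelope (jet_inf c M E f G) x + ereal (c / 2 * (norm x)\<^sup>2)" for x
      by (simp add: env F_def)
    show "convex_on UNIV (\<lambda>x. F x - c / 2 * (norm x)\<^sup>2)" using convex by (simp add: F_def)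
    show "extends_jet E f G F" using jet by (simp add: extends_jet_def grad_F F_def)
    show "C11 F"
      unfolding C11_def
    proof (intro conjI allI exI)
      show "F differentiable (at x)" for x
        using F_deriv unfolding gderiv_def differentiable_def by blast
      \<comment> \<open>A crude constant that works for every \<open>c\<close>: \<open>p\<close> is
        \<open>L\<close>-Lipschitz by the shift lemma with shift 0, and the term
        \<open>c *\<^sub>R x\<close> adds \<open>\<bar>c\<bar>\<close>.\<close>
      show "(L + \<bar>c\<bar>)-lipschitz_on UNIV (grad F)"
      proof (rule lipschitz_onI)
        fix x y
        have "norm (p x - p y + 0 *\<^sub>R (x - y)) \<le> (L + 0) * norm (x - y)"
          using \<open>L > 0\<close> coco by (intro cocoercive_shift_lipschitz) auto
        then show "dist (grad F x) (grad F y) \<le> (L + \<bar>c\<bar>) * dist x y"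
          unfolding dist_norm grad_diff using norm_triangle_ineq[of "p x - p y" "c *\<^sub>R (x - y)"]
          by (simp add: distrib_right)
      qed (use \<open>L > 0\<close> in simp)
    qed
    show "Lip (grad F) \<le> ennreal M" if "- M \<le> c"
    proof -
      have "norm (grad F x - grad F y) \<le> M * norm (x - y)" for x y
        using cocoercive_shift_lipschitz[OF \<open>L > 0\<close> _ coco, of c x y] that
        by (simp add: L_def grad_diff)
      then show ?thesis using \<open>M > 0\<close> by (simp add: Lip_le_iff)
    qed
  qed
qed

lemma extension_le_conv_envelope:
  fixes H :: "'a::{real_inner, banach} \<Rightarrow> real"
  assumes "M > 0" and C11: "C11 H" and ext: "extends_jet E f G H"
    and lip: "Lip (grad H) \<le> ennreal M"
    and convex: "convex_on UNIV (\<lambda>x. H x - c / 2 * (norm x)\<^sup>2)"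
  shows "ereal (H x) \<le> conv_envelope (jet_inf c M E f G) x + ereal (c / 2 * (norm x)\<^sup>2)"
proof -
  have "ereal (H x - c / 2 * (norm x)\<^sup>2) \<le> conv_envelope (jet_inf c M E f G) x"
  proof (rule conv_envelope_upper[OF convex])
    have "isCont H x" for x
      using C11 by (intro differentiable_imp_continuous_within) (simp add: C11_def)
    then show "isCont (\<lambda>x. H x - c / 2 * (norm x)\<^sup>2) x" for x by (intro continuous_intros)
    show "ereal (H x - c / 2 * (norm x)\<^sup>2) \<le> jet_inf c M E f G x" for x
      unfolding le_jet_inf_iff
    proof
      fix y assume "y \<in> E"
      then have "f y = H y" "G y = grad H y" using ext by (simp_all add: extends_jet_def)
      then show "H x - c / 2 * (norm x)\<^sup>2 \<le> f y - c / 2 * (norm y)\<^sup>2 + (G y - c *\<^sub>R y) \<bullet> (x - y)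
          + (M - c) / 2 * (norm (x - y))\<^sup>2"
        using C11_upper_paraboloid[OF C11 lip \<open>M > 0\<close>] by simp
    qed
  qed
  then have "ereal (H x - c / 2 * (norm x)\<^sup>2) + ereal (c / 2 * (norm x)\<^sup>2)
    \<le> conv_envelope (jet_inf c M E f G) x + ereal (c / 2 * (norm x)\<^sup>2)"
    by (intro add_mono) auto
  then show ?thesis by simp
qed

theorem theorem13:
  fixes E :: "'a::{real_inner, banach} set"
    and f :: "'a \<Rightarrow> real" and G :: "'a \<Rightarrow> 'a" and c M :: real
  assumes "E \<noteq> {}" and "M > 0" and "M > c"
  shows
    "(- M \<le> c \<longrightarrow>
       ((\<exists>F. C11 F \<and> extends_jet E f G F \<and> Lip (grad F) \<le> ennreal M
             \<and> convex_on UNIV (\<lambda>x. F x - c / 2 * (norm x)\<^sup>2))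
        \<longleftrightarrow> SCW11 c M E f G))
     \<and> ((\<exists>F. C11 F \<and> extends_jet E f G F \<and> Lip (grad F) \<le> ennreal M
             \<and> convex_on UNIV (\<lambda>x. F x - c / 2 * (norm x)\<^sup>2))
        \<longrightarrow> SCW11 c M E f G)
     \<and> (SCW11 c M E f G \<longrightarrow>
         (\<exists>F. (\<forall>x. ereal (F x) = conv_envelope (jet_inf c M E f G) x + ereal (c / 2 * (norm x)\<^sup>2))
             \<and> C11 F \<and> extends_jet E f G F
             \<and> (- M \<le> c \<longrightarrow> Lip (grad F) \<le> ennreal M)
             \<and> convex_on UNIV (\<lambda>x. F x - c / 2 * (norm x)\<^sup>2)
             \<and> (\<forall>H. C11 H \<and> extends_jet E f G H \<and> Lip (grad H) \<le> ennreal M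
                    \<and> convex_on UNIV (\<lambda>x. H x - c / 2 * (norm x)\<^sup>2)
                    \<longrightarrow> (\<forall>x. H x \<le> F x))))"
  (is "(_ \<longrightarrow> (\<exists>F. ?ext F) \<longleftrightarrow> _) \<and> _ \<and> _")
proof -
  have only_if: "SCW11 c M E f G" if "\<exists>F. ?ext F"
    using that SCW11_of_extension[OF assms(2,3)] by blast
  have formula: "\<exists>F. (\<forall>x. ereal (F x) = conv_envelope (jet_inf c M E f G) x + ereal (c / 2 * (norm x)\<^sup>2))
      \<and> C11 F \<and> extends_jet E f G F \<and> (- M \<le> c \<longrightarrow> Lip (grad F) \<le> ennreal M)
      \<and> convex_on UNIV (\<lambda>x. F x - c / 2 * (norm x)\<^sup>2)
      \<and> (\<forall>H. ?ext H \<longrightarrow> (\<forall>x. H x \<le> F x))"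
    if scw: "SCW11 c M E f G"
  proof -
    obtain F where F: "\<And>x. ereal (F x) = conv_envelope (jet_inf c M E f G) x + ereal (c / 2 * (norm x)\<^sup>2)"
      "C11 F" "extends_jet E f G F" "- M \<le> c \<Longrightarrow> Lip (grad F) \<le> ennreal M"
      "convex_on UNIV (\<lambda>x. F x - c / 2 * (norm x)\<^sup>2)"
      using extension_of_SCW11[OF assms scw] by blast
    have "H x \<le> F x" if "?ext H" for H x
    proof -
      have "ereal (H x) \<le> ereal (F x)"
        unfolding F(1) using that by (intro extension_le_conv_envelope[OF assms(2)]) auto
      then show ?thesis by simp
    qed
    with F show ?thesis by blast
  qed
  show ?thesis
  proof (intro conjI impI iffI)
    \<comment> \<open>For \<open>- M \<le> c\<close> the function given by the formula is itself the
      required extension.\<close>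
    assume "- M \<le> c" "SCW11 c M E f G"
    then show "\<exists>F. ?ext F" using formula by blast
  qed (use only_if formula in blast)+
qed

end
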